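(* Let $K$ be an arbitrary field, $x=(x_1,\ldots,x_n)$, and let $M\in\operatorname{Mat}_{m,n}(K[x])$ be a matrix whose entries are polynomials of degree at most $1$ over $K$. Suppose that $\operatorname{rk} M=1$. Then $M$ is equivalent over $K$ to a matrix $\tilde M$ for which one of the following holds: (1) only the first column of $\tilde M$ is nonzero (all other columns are zero); (2) only the first row of $\tilde M$ is nonzero (all other rows are zero). If, in addition, $M$ is the Jacobian matrix of a polynomial map, then $\tilde M$ can be chosen such that (2) holds, or (1) holds together with the following additional assertion: the first column of $\tilde M$ is of the form $( *,\tfrac12,0,\ldots,0)$ (in particular $\tfrac12\in K$ in that case).
   Context: $\operatorname{Mat}_{m,n}(R)$ denotes the $m\times n$ matrices over $R$. The rank $\operatorname{rk} M$ of $M\in\operatorname{Mat}_{m,n}(K[x])$ is its rank over the field of fractions $K(x)$. Two matrices $M,\tilde M\in\operatorname{Mat}_{m,n}(K[x])$ are equivalent over $K$ if there exist $S\in\operatorname{GL}_m(K)$ and $T\in\operatorname{GL}_n(K)$ with $\tilde M=SMT$. A polynomial map $H=(H_1,\ldots,H_m)\in K[x]^m$ has Jacobian matrix $\mathcal{J}H=\left(\frac{\partial H_i}{\partial x_j}\right)_{1\le i\le m,\,1\le j\le n}$; a matrix is the Jacobian matrix of a polynomial map if it equals $\mathcal{J}H$ for some $H\in K[x]^m$. The notation $( *,\tfrac12,0,\ldots,0)$ means: the first entry is arbitrary, the second entry is the constant $\tfrac12\in K$, and all further entries are zero. $\tfrac12\in K$ means that the characteristic of $K$ is not $2$. *)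

theory Defs
  imports
    "HOL-Analysis.Analysis"
    "HOL-Library.Poly_Mapping"
    "HOL-Computational_Algebra.Fraction_Field"
begin

text \<open>
  The polynomial ring \<open>K[x\<^sub>1, \<dots>, x\<^sub>n]\<close>: finitely supported maps from monomials to coefficients,
  a monomial being a finitely supported exponent vector. The variables are the elements of the
  finite type \<open>'n\<close>, so \<open>n = CARD('n)\<close>. The linear order on \<open>'n\<close> fixes the enumeration
  \<open>x\<^sub>1 < \<dots> < x\<^sub>n\<close>; it is also what the library requires for polynomials to be
  an integral domain, so that the fraction field \<open>K(x)\<close> is the type \<open>('n, 'a) mpoly fract\<close>.
\<close>

type_synonym ('n, 'a) mpoly = "('n \<Rightarrow>\<^sub>0 nat) \<Rightarrow>\<^sub>0 'a"

definition Const :: "'a::zero \<Rightarrow> ('n, 'a) mpoly" where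
  "Const c = Poly_Mapping.single 0 c"

definition monom_degree :: "('n::finite \<Rightarrow>\<^sub>0 nat) \<Rightarrow> nat" where
  "monom_degree t = (\<Sum>i\<in>UNIV. Poly_Mapping.lookup t i)"

text \<open>The zero polynomial gets total degree \<open>0\<close>.\<close>

definition total_degree :: "('n::finite, 'a::zero) mpoly \<Rightarrow> nat" where
  "total_degree p = Max (insert 0 (monom_degree ` Poly_Mapping.keys p))"

text \<open>
  The formal partial derivative. The truncated subtraction in the exponent is harmless: a monomial
  not involving \<open>x\<^sub>j\<close> gets the coefficient \<open>0\<close>.
\<close>

definition partial_deriv :: "'n \<Rightarrow> ('n, 'a::comm_semiring_1) mpoly \<Rightarrow> ('n, 'a) mpoly" where
  "partial_deriv j p =
     (\<Sum>t\<in>Poly_Mapping.keys p.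
        Poly_Mapping.single (t - Poly_Mapping.single j 1)
          (of_nat (Poly_Mapping.lookup t j) * Poly_Mapping.lookup p t))"

lemma lookup_partial_deriv:
  "Poly_Mapping.lookup (partial_deriv j p) s =
     of_nat (Poly_Mapping.lookup s j + 1) * Poly_Mapping.lookup p (s + Poly_Mapping.single j 1)"
proof -
  let ?u = "s + Poly_Mapping.single j 1"
  have eq: "(of_nat (Poly_Mapping.lookup t j) * Poly_Mapping.lookup p t
               when t - Poly_Mapping.single j 1 = s)
          = (if t = ?u
             then of_nat (Poly_Mapping.lookup s j + 1) * Poly_Mapping.lookup p ?u else 0)" for t
  proof (cases "Poly_Mapping.lookup t j = 0")
    case True
    then have "t \<noteq> ?u" by (auto simp: lookup_add lookup_single)
    with True show ?thesis by simp
  next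
    case False
    then have "t - Poly_Mapping.single j 1 + Poly_Mapping.single j 1 = t"
      by (intro poly_mapping_eqI) (auto simp: lookup_add lookup_minus lookup_single when_def)
    then have "t - Poly_Mapping.single j 1 = s \<longleftrightarrow> t = ?u" by auto
    then show ?thesis by (auto simp: lookup_add lookup_single when_def)
  qed
  show ?thesis
    unfolding partial_deriv_def lookup_sum lookup_single eq
    by (auto simp: in_keys_iff)
qed

text \<open>
  Following the library, an \<open>m \<times> n\<close> matrix has type \<open>'r ^ 'n ^ 'm\<close> and \<open>M $ i $ j\<close> is its
  entry in row \<open>i\<close> and column \<open>j\<close>.
\<close>

definition jacobian :: "('n, 'a::comm_semiring_1) mpoly ^ 'm \<Rightarrow> ('n, 'a) mpoly ^ 'n ^ 'm" where
  "jacobian H = (\<chi> i j. partial_deriv j (H $ i))"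

definition is_jacobian :: "('n, 'a::comm_semiring_1) mpoly ^ 'n ^ 'm \<Rightarrow> bool" where
  "is_jacobian M \<longleftrightarrow> (\<exists>H. M = jacobian H)"

definition mpoly_rank ::
  "('n, 'a::field) mpoly ^ 'n::{finite,linorder} ^ 'm \<Rightarrow> nat" where
  "mpoly_rank M = rank (map_matrix (\<lambda>p. Fract p 1) M)"

definition equivalent_over ::
  "('n, 'a::field) mpoly ^ 'n ^ 'm \<Rightarrow> ('n, 'a) mpoly ^ 'n ^ 'm \<Rightarrow> bool" where
  "equivalent_over M M' \<longleftrightarrow>
     (\<exists>(S :: 'a ^ 'm ^ 'm) (T :: 'a ^ 'n ^ 'n).
        invertible S \<and> invertible T \<and> M' = map_matrix Const S ** M ** map_matrix Const T)"

definition first_index :: "'i::{finite,linorder}" where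
  "first_index = Min UNIV"

text \<open>Meaningful only if \<open>'i\<close> has at least two elements.\<close>

definition second_index :: "'i::{finite,linorder}" where
  "second_index = Min (UNIV - {first_index})"

definition only_first_column_nonzero ::
  "'r::zero ^ 'n::{finite,linorder} ^ 'm \<Rightarrow> bool" where
  "only_first_column_nonzero A \<longleftrightarrow>
     column first_index A \<noteq> 0 \<and> (\<forall>j. j \<noteq> first_index \<longrightarrow> column j A = 0)"

definition only_first_row_nonzero ::
  "'r::zero ^ 'n ^ 'm::{finite,linorder} \<Rightarrow> bool" where
  "only_first_row_nonzero A \<longleftrightarrow>
     row first_index A \<noteq> 0 \<and> (\<forall>i. i \<noteq> first_index \<longrightarrow> row i A = 0)"

text \<open>
  The shape \<open>(*, 1/2, 0, \<dots>, 0)\<close>. It presupposes that there is a second entry and that \<open>1/2\<close>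
  exists in the field; the latter has to be required, as \<open>1 / 0 = 0\<close> in HOL.
\<close>

definition star_half_zeros :: "('n, 'a::field) mpoly ^ 'm::{finite,linorder} \<Rightarrow> bool" where
  "star_half_zeros v \<longleftrightarrow>
     CARD('m) \<ge> 2 \<and> (2::'a) \<noteq> 0 \<and> v $ second_index = Const (1 / 2) \<and>
     (\<forall>i. i \<noteq> first_index \<and> i \<noteq> second_index \<longrightarrow> v $ i = 0)"

end

theory Submission
  imports Defs
begin

text \<open>
  Rank one means that all \<open>2 \<times> 2\<close> minors of \<open>M\<close> vanish. Since the entries have degree at most \<open>1\<close>,
  comparing coefficients shows that the matrices \<open>A\<^sub>t\<close> of coefficients of the monomials
  \<open>t = 1, x\<^sub>1, \<dots>, x\<^sub>n\<close> have rank at most one, and so have the sums of two of them.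
  Hence \<open>A\<^sub>t = u\<^sub>t v\<^sub>t\<^sup>T\<close>, where for any two indices the \<open>u\<close>'s or the \<open>v\<close>'s are parallel; then all \<open>u\<close>'s or all
  \<open>v\<close>'s are parallel, that is, \<open>M = u w\<^sup>T\<close> or \<open>M = p d\<^sup>T\<close> with \<open>u\<close> or \<open>d\<close> constant.

  If \<open>M = p d\<^sup>T\<close> is a Jacobian matrix, symmetry of the second derivatives forces
  \<open>p = \<beta> + l \<alpha>\<close> with \<open>l = \<Sum>\<^sub>k d\<^sub>k x\<^sub>k\<close> and constant vectors \<open>\<alpha>\<close>, \<open>\<beta>\<close>. If these are
  dependent, then \<open>M\<close> is also of the first kind; otherwise \<open>\<alpha> \<noteq> 0\<close> excludes characteristic \<open>2\<close>,
  and a change of basis sends \<open>\<alpha>\<close>, \<open>\<beta>\<close> to \<open>e\<^sub>1\<close>, \<open>e\<^sub>2 / 2\<close>.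
\<close>

section \<open>Constant polynomials and their coefficients\<close>

abbreviation lookup :: "('b \<Rightarrow>\<^sub>0 'c::zero) \<Rightarrow> 'b \<Rightarrow> 'c" where
  "lookup \<equiv> Poly_Mapping.lookup"

lemma Const_0 [simp]: "Const 0 = 0"
  by (simp add: Const_def)

lemma Const_1 [simp]: "Const (1 :: 'a::comm_semiring_1) = 1"
  by (simp add: Const_def)

lemma Const_add: "Const (a + b :: 'a::comm_semiring_1) = Const a + Const b"
  by (simp add: Const_def single_add)

lemma Const_mult: "Const (a * b :: 'a::comm_semiring_1) = Const a * Const b"
  by (simp add: Const_def mult_single)

lemma Const_sum: "Const (\<Sum>x\<in>A. f x) = (\<Sum>x\<in>A. Const (f x :: 'a::comm_semiring_1))"
  by (induction A rule: infinite_finite_induct) (simp_all add: Const_add)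

lemma lookup_Const_mult [simp]:
  "lookup (Const (c :: 'a::comm_semiring_1) * p :: ('n, 'a) mpoly) t = c * lookup p t"
proof -
  \<comment> \<open>Pulling the condition \<open>0 = l\<close> to the outside leaves an outer sum
    with the single term \<open>l = 0\<close>.\<close>
  have "Sum_any (\<lambda>l. (c when (0 :: 'n \<Rightarrow>\<^sub>0 nat) = l) * Sum_any (\<lambda>q. lookup p q when t = l + q)) =
      Sum_any (\<lambda>l. c * Sum_any (\<lambda>q. lookup p q when t = l + q) when 0 = l)"
    by (simp add: when_mult)
  then show ?thesis
    by (simp add: Const_def lookup_mult lookup_single)
qed

section \<open>Products of polynomials of degree at most one\<close>

definition affine_monomials :: "('n \<Rightarrow>\<^sub>0 nat) set" where
  "affine_monomials = insert 0 (range (\<lambda>k. Poly_Mapping.single k 1))"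

lemma finite_affine_monomials [simp]: "finite (affine_monomials :: ('n::finite \<Rightarrow>\<^sub>0 nat) set)"
  by (simp add: affine_monomials_def)

lemma affine_monomials_eq_single:
  assumes "s \<in> affine_monomials" "lookup s i \<noteq> 0"
  shows "s = Poly_Mapping.single i 1"
  using assms by (auto simp: affine_monomials_def lookup_single when_def split: if_splits)

lemma monom_degree_le_1_imp_affine:
  assumes "monom_degree t \<le> 1"
  shows "t \<in> affine_monomials"
proof (cases "t = 0")
  case False
  then obtain i where i: "lookup t i \<noteq> 0"
    by (metis poly_mapping_eqI lookup_zero)
  have "(\<Sum>k\<in>UNIV. lookup t k) = lookup t i + (\<Sum>k\<in>UNIV - {i}. lookup t k)"
    by (simp add: sum.remove)
  with assms i have "lookup t i = 1" "(\<Sum>k\<in>UNIV - {i}. lookup t k) = 0"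
    by (auto simp: monom_degree_def simp del: sum_eq_0_iff)
  then have "lookup t i = 1" "\<forall>k. k \<noteq> i \<longrightarrow> lookup t k = 0"
    by simp_all
  then have "t = Poly_Mapping.single i 1"
    by (intro poly_mapping_eqI) (auto simp: lookup_single when_def)
  then show ?thesis
    by (auto simp: affine_monomials_def)
qed (simp add: affine_monomials_def)

lemma lookup_eq_0_if_degree_le_1:
  assumes "total_degree p \<le> 1" "t \<notin> affine_monomials"
  shows "lookup p t = 0"
proof (rule ccontr)
  assume "lookup p t \<noteq> 0"
  then have "monom_degree t \<le> total_degree p"
    by (auto simp: total_degree_def in_keys_iff intro!: Max_ge)
  with assms monom_degree_le_1_imp_affine show False
    by force
qed

text \<open>A variable dividing the product is a factor on both sides, and cancelling it identifies
  the other factor. If no variable divides the product, all four monomials are trivial.\<close>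

lemma affine_monomials_add_eq_iff:
  assumes "s \<in> affine_monomials" "t \<in> affine_monomials"
    "l \<in> affine_monomials" "q \<in> affine_monomials"
  shows "l + q = s + t \<longleftrightarrow> l = s \<and> q = t \<or> l = t \<and> q = s"
proof
  assume eq: "l + q = s + t"
  have *: "l = s \<and> q = t \<or> l = t \<and> q = s"
    if "l = Poly_Mapping.single i 1" "l + q = s + t" for i l q
  proof -
    have "lookup (s + t) i \<noteq> 0"
      using that by (simp flip: that(2) add: lookup_add)
    then have "l = s \<or> l = t"
      using that(1) assms(1,2) affine_monomials_eq_single by (fastforce simp: lookup_add)
    then show ?thesis
      using that(2) by (metis add.commute add_left_imp_eq)
  qed
  consider i where "l = Poly_Mapping.single i 1" | i where "q = Poly_Mapping.single i 1"
    | "l = 0" "q = 0"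
    using assms(3,4) by (auto simp: affine_monomials_def)
  then show "l = s \<and> q = t \<or> l = t \<and> q = s"
  proof cases
    case 1
    with * eq show ?thesis by blast
  next
    case 2
    with *[of q _ l] eq show ?thesis by (metis add.commute)
  next
    case 3
    then have "lookup s i + lookup t i = 0" for i
      using eq by (metis lookup_add add.left_neutral lookup_zero)
    then have "s = 0" "t = 0"
      by (auto intro: poly_mapping_eqI)
    with 3 show ?thesis by simp
  qed
qed (auto simp: add.commute)

text \<open>Only the factorisations \<open>(s, t)\<close> and \<open>(t, s)\<close> contribute. They
  coincide for \<open>s = t\<close>, so the coefficient at a square carries no factor 2 and remains
  informative in characteristic 2.\<close>

lemma lookup_affine_mult:
  fixes f g :: "('n::finite, 'a::comm_semiring_1) mpoly"
  assumes deg: "total_degree f \<le> 1" "total_degree g \<le> 1"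
    and st: "s \<in> affine_monomials" "t \<in> affine_monomials"
  shows "lookup (f * g) (s + t) =
    (if s = t then lookup f s * lookup g s else lookup f s * lookup g t + lookup f t * lookup g s)"
proof -
  let ?A = "affine_monomials :: ('n \<Rightarrow>\<^sub>0 nat) set"
  have inner: "Sum_any (\<lambda>q. lookup g q when s + t = l + q) = (\<Sum>q\<in>?A. lookup g q when s + t = l + q)" for l
    by (rule Sum_any.expand_superset) (use deg(2) lookup_eq_0_if_degree_le_1 in force)+
  have "lookup (f * g) (s + t) = (\<Sum>l\<in>?A. lookup f l * (\<Sum>q\<in>?A. lookup g q when s + t = l + q))"
    unfolding lookup_mult inner
    by (rule Sum_any.expand_superset) (use deg(1) lookup_eq_0_if_degree_le_1 in force)+
  also have "\<dots> = (\<Sum>(l, q)\<in>?A \<times> ?A. if l + q = s + t then lookup f l * lookup g q else 0)"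
    by (simp add: sum_distrib_left sum.cartesian_product when_def eq_commute if_distrib cong: if_cong)
  also have "\<dots> = (\<Sum>(l, q)\<in>{(s, t), (t, s)}. lookup f l * lookup g q)"
    using st by (intro sum.mono_neutral_cong_right) (auto simp: affine_monomials_add_eq_iff split: if_splits)
  also have "\<dots> = (if s = t then lookup f s * lookup g s else lookup f s * lookup g t + lookup f t * lookup g s)"
    by simp
  finally show ?thesis .
qed

section \<open>Families of matrices of rank at most one\<close>

text \<open>The factors are the column and the row through a nonzero entry, the row being divided by
  that entry.\<close>

lemma minors_eq_0_imp_outer_product:
  fixes a :: "'i \<Rightarrow> 'j \<Rightarrow> 'a::field"
  assumes "\<And>i j k l. a i j * a k l = a i l * a k j"
  obtains u v where "\<And>i j. a i j = u i * v j"
proof (cases "\<exists>i j. a i j \<noteq> 0")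
  case True
  then obtain i0 j0 where "a i0 j0 \<noteq> 0" by blast
  then have "a i j = a i j0 * (a i0 j / a i0 j0)" for i j
    using assms[of i j i0 j0] by (simp add: field_simps)
  then show ?thesis by (rule that)
next
  case False
  then show ?thesis using that[of "\<lambda>_. 0" "\<lambda>_. 0"] by simp
qed

text \<open>Proportionality through vanishing minors is symmetric and needs no division, but makes
  the zero vector parallel to everything. Transitivity therefore needs a nonzero middle
  vector.\<close>

definition parallel :: "('i \<Rightarrow> 'a::field) \<Rightarrow> ('i \<Rightarrow> 'a) \<Rightarrow> bool" where
  "parallel x y \<longleftrightarrow> (\<forall>i k. x i * y k = y i * x k)"

lemma parallel_sym: "parallel x y \<Longrightarrow> parallel y x"
  by (simp add: parallel_def mult.commute)

lemma parallel_scaled: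
  assumes "parallel x y" "y i0 \<noteq> 0"
  shows "x i = (x i0 / y i0) * y i"
proof -
  have "x i * y i0 = y i * x i0"
    using assms(1) by (simp add: parallel_def)
  with assms(2) show ?thesis by (simp add: field_simps)
qed

lemma parallel_trans:
  assumes "parallel x y" "parallel y z" "y \<noteq> (\<lambda>_. 0)"
  shows "parallel x z"
proof -
  from assms(3) obtain i0 where i0: "y i0 \<noteq> 0" by auto
  have "x i * z k = z i * x k" for i k
    by (simp add: parallel_scaled[OF assms(1) i0, of i] parallel_scaled[OF assms(1) i0, of k]
        parallel_scaled[OF parallel_sym[OF assms(2)] i0, of i]
        parallel_scaled[OF parallel_sym[OF assms(2)] i0, of k])
  then show ?thesis
    by (simp add: parallel_def)
qed

text \<open>
  The second assumption says, given the first, that the sum of any two of the matrices has rank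
  at most one as well.
\<close>

lemma rank_one_family:
  fixes a :: "'t \<Rightarrow> 'i \<Rightarrow> 'j \<Rightarrow> 'a::field"
  assumes minor: "\<And>t i j k l. a t i j * a t k l = a t i l * a t k j"
    and polar: "\<And>s t i j k l. s \<noteq> t \<Longrightarrow>
      a s i j * a t k l + a t i j * a s k l = a s i l * a t k j + a t i l * a s k j"
  shows "(\<exists>u w. \<forall>t i j. a t i j = u i * w t j) \<or> (\<exists>u w. \<forall>t i j. a t i j = u t i * w j)"
proof -
  have "\<forall>t. \<exists>u v. \<forall>i j. a t i j = u i * v j"
    using minors_eq_0_imp_outer_product minor by metis
  then obtain U V where a: "\<And>t i j. a t i j = U t i * V t j"
    by metis
  have par: "parallel (U s) (U t) \<or> parallel (V s) (V t)" for s t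
  proof (cases "s = t")
    case False
    \<comment> \<open>For outer products the polar identity factors into a minor of the
      \<open>U\<close>'s times a minor of the \<open>V\<close>'s. As \<open>i\<close>,
      \<open>k\<close> and \<open>j\<close>, \<open>l\<close> vary independently, one of the two
      kinds vanishes throughout.\<close>
    have "(U s i * U t k - U t i * U s k) * (V s j * V t l - V t j * V s l) = 0" for i j k l
      using polar[OF False, of i j k l] by (simp add: a algebra_simps)
    then show ?thesis
      unfolding parallel_def by (metis eq_iff_diff_eq_0 mult_eq_0_iff)
  qed (simp add: parallel_def)
  \<comment> \<open>On the indices of nonzero matrices all \<open>U t\<close> and \<open>V t\<close>
    are nonzero, so parallelism is transitive there.\<close>
  let ?N = "{t. \<exists>i j. a t i j \<noteq> 0}"
  have nz: "U t \<noteq> (\<lambda>_. 0)" "V t \<noteq> (\<lambda>_. 0)" if "t \<in> ?N" for t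
    using that by (auto simp: a)
  have dichotomy: "(\<forall>s\<in>?N. \<forall>t\<in>?N. parallel (U s) (U t)) \<or> (\<forall>s\<in>?N. \<forall>t\<in>?N. parallel (V s) (V t))"
  proof (rule disjCI)
    assume "\<not> (\<forall>s\<in>?N. \<forall>t\<in>?N. parallel (V s) (V t))"
    then obtain p q where pq: "p \<in> ?N" "q \<in> ?N" "\<not> parallel (V p) (V q)" by blast
    \<comment> \<open>\<open>U p\<close> and \<open>U q\<close> are parallel because
      \<open>V p\<close> and \<open>V q\<close> are not. If \<open>U r\<close> were not parallel to
      \<open>U p\<close>, it would not be parallel to \<open>U q\<close> either; then
      \<open>V r\<close> would be parallel to both \<open>V p\<close> and \<open>V q\<close>, making
      these parallel.\<close>
    have "parallel (U r) (U p)" if "r \<in> ?N" for r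
    proof (rule ccontr)
      assume *: "\<not> parallel (U r) (U p)"
      have "parallel (U p) (U q)" using par pq by blast
      then have "\<not> parallel (U r) (U q)"
        using * parallel_trans nz(1)[OF pq(2)] parallel_sym by blast
      with * par have "parallel (V p) (V r)" "parallel (V r) (V q)"
        using parallel_sym by blast+
      with pq(3) parallel_trans nz(2)[OF that] show False by blast
    qed
    then show "\<forall>s\<in>?N. \<forall>t\<in>?N. parallel (U s) (U t)"
      using parallel_trans parallel_sym nz(1)[OF pq(1)] by blast
  qed
  show ?thesis
  proof (cases "?N = {}")
    case True
    then show ?thesis by (intro disjI1 exI[of _ "\<lambda>_. 0"]) auto
  next
    case False
    then obtain p where p: "p \<in> ?N" by blast
    from nz[OF p] obtain i0 j0 where ij: "U p i0 \<noteq> 0" "V p j0 \<noteq> 0" by blast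
    show ?thesis
      using dichotomy
    proof
      assume *: "\<forall>s\<in>?N. \<forall>t\<in>?N. parallel (U s) (U t)"
      \<comment> \<open>The scalar taking \<open>U p\<close> to \<open>U t\<close> is read off at
        \<open>i0\<close> and moved into the second factor. Outside \<open>?N\<close> the matrix is
        zero, so the scalar 0 serves.\<close>
      have "a t i j = U p i * ((if t \<in> ?N then U t i0 / U p i0 else 0) * V t j)" for t i j
      proof (cases "t \<in> ?N")
        case True
        with * p have "parallel (U t) (U p)" by blast
        with True a[of t i j] parallel_scaled[OF this ij(1), of i] show ?thesis by simp
      qed auto
      then show ?thesis
        by (intro disjI1 exI[of _ "U p"] exI[of _ "\<lambda>t j. (if t \<in> ?N then U t i0 / U p i0 else 0) * V t j"]) blast
    next
      assume *: "\<forall>s\<in>?N. \<forall>t\<in>?N. parallel (V s) (V t)"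
      have "a t i j = (U t i * (if t \<in> ?N then V t j0 / V p j0 else 0)) * V p j" for t i j
      proof (cases "t \<in> ?N")
        case True
        with * p have "parallel (V t) (V p)" by blast
        with True a[of t i j] parallel_scaled[OF this ij(2), of j] show ?thesis by simp
      qed auto
      then show ?thesis
        by (intro disjI2 exI[of _ "\<lambda>t i. U t i * (if t \<in> ?N then V t j0 / V p j0 else 0)"] exI[of _ "V p"]) blast
    qed
  qed
qed

section \<open>Rank one and vanishing minors\<close>

text \<open>All rows are multiples of the single basis vector of the row space.\<close>

lemma rank_1_minors:
  fixes A :: "'a::field ^ 'n ^ 'm"
  assumes "rank A = 1"
  shows "A $ i $ j * A $ k $ l = A $ i $ l * A $ k $ j"
proof -
  obtain B where B: "rows A \<subseteq> vec.span B" "card B = 1"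
    using vec.basis_exists[of "rows A"] assms by (metis row_rank_def_gen)
  then obtain b where "B = {b}" by (auto simp: card_1_singleton_iff)
  have "\<exists>c. A $ i = c *s b" for i
  proof -
    have "A $ i \<in> rows A" by (auto simp: rows_def row_def)
    with B \<open>B = {b}\<close> show ?thesis by (auto simp: vec.span_singleton)
  qed
  then obtain c where "\<And>i. A $ i = c i *s b" by metis
  then show ?thesis by (simp add: mult_ac)
qed

text \<open>The embedding into the fraction field is injective and multiplicative, so the identity
  descends to polynomials.\<close>

lemma mpoly_rank_1_minors:
  fixes M :: "('n, 'a::field) mpoly ^ 'n::{finite,linorder} ^ 'm"
  assumes "mpoly_rank M = 1"
  shows "M $ i $ j * M $ k $ l = M $ i $ l * M $ k $ j"
  using rank_1_minors[OF assms[unfolded mpoly_rank_def], of i j k l]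
  by (simp add: map_matrix_def eq_fract)

lemma mpoly_rank_1_nonzero:
  fixes M :: "('n, 'a::field) mpoly ^ 'n::{finite,linorder} ^ 'm"
  assumes "mpoly_rank M = 1"
  shows "M \<noteq> 0"
proof
  assume "M = 0"
  then have "rows (map_matrix (\<lambda>p. Fract p 1) M) \<subseteq> {0}"
    by (auto simp: rows_def row_def map_matrix_def vec_eq_iff Zero_fract_def)
  then have "vec.dim (rows (map_matrix (\<lambda>p. Fract p 1) M)) = 0"
    by simp
  with assms show False
    by (simp add: mpoly_rank_def row_rank_def_gen)
qed

section \<open>Base changes with prescribed values\<close>

text \<open>A map between independent sets extends to an injective linear map, and an injective
  endomorphism in finite dimension is invertible.\<close>

lemma exists_invertible_extension:
  fixes f :: "'a::field ^ 'n \<Rightarrow> 'a ^ 'n"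
  assumes "vec.independent B" "vec.independent (f ` B)" "inj_on f B"
  obtains S where "invertible S" "\<And>x. x \<in> B \<Longrightarrow> S *v x = f x"
proof -
  obtain g where g: "Vector_Spaces.linear (*s) (*s) g" "inj g" "\<forall>x\<in>B. g x = f x"
    using vec.linear_independent_extend_inj[OF assms] by blast
  have "invertible (matrix g)"
    unfolding invertible_left_inverse matrix_left_invertible_injective
    using g by (simp add: matrix_works)
  with g show ?thesis by (intro that) (auto simp: matrix_works)
qed


lemma invertible_mat_one: "invertible (mat 1 :: 'a::semiring_1 ^ 'n ^ 'n)"
  unfolding invertible_def by (intro exI[of _ "mat 1"]) simp

lemma invertible_transpose:
  fixes A :: "'a::comm_semiring_1 ^ 'n ^ 'n"
  assumes "invertible A"
  shows "invertible (transpose A)"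
  using assms unfolding invertible_def by (metis matrix_transpose_mul transpose_mat)

lemma exists_invertible_nonzero:
  fixes x y :: "'a::field ^ 'n"
  assumes "x \<noteq> 0" "y \<noteq> 0"
  obtains S where "invertible S" "S *v x = y"
proof -
  have "vec.independent {x}" "vec.independent ((\<lambda>_. y) ` {x})"
    using assms by simp_all
  then obtain S where "invertible S" "\<And>z. z \<in> {x} \<Longrightarrow> S *v z = y"
    by (rule exists_invertible_extension[where f = "\<lambda>_. y"]) auto
  then show ?thesis by (intro that) auto
qed

lemma exists_invertible_pair:
  fixes x y x' y' :: "'a::field ^ 'n"
  assumes "vec.independent {x, y}" "x \<noteq> y" "vec.independent {x', y'}" "x' \<noteq> y'"
  obtains S where "invertible S" "S *v x = x'" "S *v y = y'"
proof -
  let ?f = "\<lambda>z. if z = x then x' else y'"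
  have "?f ` {x, y} = {x', y'}" "inj_on ?f {x, y}"
    using assms(2,4) by (auto simp: inj_on_def)
  with assms(1,3) obtain S where "invertible S" "\<And>z. z \<in> {x, y} \<Longrightarrow> S *v z = ?f z"
    using exists_invertible_extension[of "{x, y}" ?f] by metis
  with assms(2) show ?thesis by (intro that) auto
qed

lemma independent_pair_iff:
  fixes x y :: "'a::field ^ 'n"
  assumes "x \<noteq> y"
  shows "vec.independent {x, y} \<longleftrightarrow> y \<noteq> 0 \<and> (\<forall>c. x \<noteq> c *s y)"
  using assms by (auto simp: vec.independent_insert vec.span_singleton)

section \<open>Normal forms of outer products under equivalence\<close>

text \<open>Row operations touch only the left factor and column operations only the right one, so
  \<open>S\<close> and \<open>T\<close> can be chosen separately.\<close>

lemma equivalent_over_outer_product: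
  fixes M :: "('n, 'a::field) mpoly ^ 'n::finite ^ 'm::finite"
  assumes "\<And>i j. M $ i $ j = p i * q j" "invertible S" "invertible T"
  shows "equivalent_over M
    (\<chi> i j. (\<Sum>k\<in>UNIV. Const (S $ i $ k) * p k) * (\<Sum>l\<in>UNIV. q l * Const (T $ l $ j)))"
proof -
  have "(map_matrix Const S ** M ** map_matrix Const T) $ i $ j =
      (\<Sum>k\<in>UNIV. Const (S $ i $ k) * p k) * (\<Sum>l\<in>UNIV. q l * Const (T $ l $ j))" for i j
    by (simp add: matrix_matrix_mult_def map_matrix_def assms(1) sum_distrib_left sum_distrib_right mult_ac)
  then show ?thesis
    unfolding equivalent_over_def using assms(2,3)
    by (intro exI[of _ S] exI[of _ T]) (simp add: vec_eq_iff)
qed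

lemma Const_matrix_vector_mult:
  fixes S :: "'a::comm_semiring_1 ^ 'n ^ 'm"
  shows "(\<Sum>k\<in>UNIV. Const (S $ i $ k) * Const (x $ k)) = Const ((S *v x) $ i)"
  by (simp add: matrix_vector_mult_def Const_sum Const_mult)

text \<open>This lets a base change chosen for column vectors act, transposed, on the right factor
  of an outer product.\<close>

lemma Const_transpose_matrix_vector_mult:
  fixes S :: "'a::comm_semiring_1 ^ 'm ^ 'n"
  shows "(\<Sum>k\<in>UNIV. Const (x $ k) * Const (transpose S $ k $ i)) = Const ((S *v x) $ i)"
  by (simp add: matrix_vector_mult_def Const_sum Const_mult transpose_def mult.commute)

text \<open>\<open>S\<close> sends \<open>v\<close> to the first unit vector, while \<open>T\<close>
  is the identity.\<close>

lemma only_first_row_form: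
  fixes M :: "('n, 'a::field) mpoly ^ 'n::finite ^ 'm::{finite,linorder}"
  assumes M: "\<And>i j. M $ i $ j = Const (v $ i) * w j" and "M \<noteq> 0"
  obtains M' where "equivalent_over M M'" "only_first_row_nonzero M'"
proof -
  have "v \<noteq> 0"
    using assms by (force simp: vec_eq_iff)
  moreover have "(axis first_index 1 :: ('a, 'm) vec) \<noteq> 0"
    by simp
  ultimately obtain S where S: "invertible S" "S *v v = (axis first_index 1 :: ('a, 'm) vec)"
    using exists_invertible_nonzero by blast
  have "w \<noteq> (\<lambda>_. 0)"
    using assms by (force simp: vec_eq_iff)
  then obtain j where "w j \<noteq> 0" by auto
  have "equivalent_over M
      (\<chi> i j. (\<Sum>k\<in>UNIV. Const (S $ i $ k) * Const (v $ k)) * (\<Sum>l\<in>UNIV. w l * Const (mat 1 $ l $ j)))"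
    using M S(1) invertible_mat_one by (intro equivalent_over_outer_product) auto
  moreover have "(\<Sum>k\<in>UNIV. Const (S $ i $ k) * Const (v $ k)) * (\<Sum>l\<in>UNIV. w l * Const (mat 1 $ l $ j)) =
      (if i = first_index then w j else 0)" for i j
    unfolding Const_matrix_vector_mult S(2)
    by (auto simp: axis_def mat_def if_distrib cong: if_cong)
  ultimately have "equivalent_over M (\<chi> i j. if i = first_index then w j else 0)"
    by simp
  then show ?thesis
    by (rule that) (use \<open>w j \<noteq> 0\<close> in \<open>auto simp: only_first_row_nonzero_def row_def vec_eq_iff\<close>)
qed

text \<open>\<open>T\<close> is chosen to send \<open>d\<close> to the first unit vector.
  \<open>S\<close> stays free, so that the remaining column can be normalised in the Jacobian
  case.\<close>

lemma only_first_column_form: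
  fixes M :: "('n, 'a::field) mpoly ^ 'n::{finite,linorder} ^ 'm::finite"
  assumes M: "\<And>i j. M $ i $ j = p i * Const (d $ j)" and "M \<noteq> 0" and S: "invertible S"
  obtains M' where "equivalent_over M M'" "only_first_column_nonzero M'"
    "column first_index M' = (\<chi> i. \<Sum>k\<in>UNIV. Const (S $ i $ k) * p k)"
proof -
  let ?c = "\<lambda>i. \<Sum>k\<in>UNIV. Const (S $ i $ k) * p k"
  have "d \<noteq> 0"
    using assms(1,2) by (force simp: vec_eq_iff)
  moreover have "(axis first_index 1 :: ('a, 'n) vec) \<noteq> 0"
    by simp
  ultimately obtain T where T: "invertible T" "T *v d = (axis first_index 1 :: ('a, 'n) vec)"
    using exists_invertible_nonzero by blast
  have "equivalent_over M
      (\<chi> i j. ?c i * (\<Sum>l\<in>UNIV. Const (d $ l) * Const (transpose T $ l $ j)))"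
    by (rule equivalent_over_outer_product[OF M S invertible_transpose[OF T(1)]])
  moreover have "?c i * (\<Sum>l\<in>UNIV. Const (d $ l) * Const (transpose T $ l $ j)) =
      (if j = first_index then ?c i else 0)" for i j
    unfolding Const_transpose_matrix_vector_mult T(2) by (auto simp: axis_def)
  ultimately have equiv: "equivalent_over M (\<chi> i j. if j = first_index then ?c i else 0)"
    by simp
  have "\<exists>i. ?c i \<noteq> 0"
  proof (rule ccontr)
    assume "\<not> (\<exists>i. ?c i \<noteq> 0)"
    then have c: "?c i = 0" for i by simp
    \<comment> \<open>The left inverse \<open>R\<close> recovers \<open>p\<close> from the
      transformed column; if that column vanished, \<open>M\<close> would be zero.\<close>
    obtain R where R: "R ** S = mat 1"
      using S invertible_left_inverse by blast
    have "p i = 0" for i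
    proof -
      have "p i = (\<Sum>k\<in>UNIV. Const ((R ** S) $ i $ k) * p k)"
        by (simp add: R mat_def if_distrib if_distribR cong: if_cong)
      also have "\<dots> = (\<Sum>k\<in>UNIV. \<Sum>l\<in>UNIV. Const (R $ i $ l) * (Const (S $ l $ k) * p k))"
        by (simp add: matrix_matrix_mult_def Const_sum Const_mult sum_distrib_right mult.assoc)
      also have "\<dots> = (\<Sum>l\<in>UNIV. Const (R $ i $ l) * ?c l)"
        by (subst sum.swap) (simp add: sum_distrib_left)
      finally show ?thesis by (simp add: c)
    qed
    with assms(1,2) show False by (simp add: vec_eq_iff)
  qed
  with equiv show ?thesis
    by (intro that) (auto simp: only_first_column_nonzero_def column_def vec_eq_iff)
qed

section \<open>Linear coefficients of Jacobian matrices\<close>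

definition linear_form :: "'a::comm_semiring_1 ^ 'n \<Rightarrow> ('n::finite, 'a) mpoly" where
  "linear_form d = (\<Sum>k\<in>UNIV. Poly_Mapping.single (Poly_Mapping.single k 1) (d $ k))"

lemma single_1_inj: "Poly_Mapping.single i (1::nat) = Poly_Mapping.single j 1 \<longleftrightarrow> i = j"
  by (metis lookup_single_eq lookup_single_not_eq zero_neq_one)

lemma single_1_nonzero: "Poly_Mapping.single i (1::nat) \<noteq> 0"
  by (metis lookup_single_eq lookup_zero zero_neq_one)

lemma lookup_linear_form:
  "lookup (linear_form d) (Poly_Mapping.single k 1) = d $ k"
  "t \<notin> range (\<lambda>k. Poly_Mapping.single k 1) \<Longrightarrow> lookup (linear_form d) t = 0"
proof -
  show "lookup (linear_form d) (Poly_Mapping.single k 1) = d $ k"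
    by (simp add: linear_form_def lookup_sum lookup_single when_def single_1_inj del: One_nat_def)
  show "lookup (linear_form d) t = 0" if "t \<notin> range (\<lambda>k. Poly_Mapping.single k 1)"
    unfolding linear_form_def lookup_sum lookup_single using that by (intro sum.neutral) auto
qed

lemma degree_le_1_eq_Const_plus_linear_form:
  fixes p :: "('n::finite, 'a::comm_semiring_1) mpoly"
  assumes "total_degree p \<le> 1" "\<And>k. lookup p (Poly_Mapping.single k 1) = a * d $ k"
  shows "p = Const (lookup p 0) + Const a * linear_form d"
proof (rule poly_mapping_eqI)
  fix t :: "'n \<Rightarrow>\<^sub>0 nat"
  consider "t = 0" | k where "t = Poly_Mapping.single k 1" | "t \<notin> affine_monomials"
    by (auto simp: affine_monomials_def)
  then show "lookup p t = lookup (Const (lookup p 0) + Const a * linear_form d) t"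
  proof cases
    case 1
    have "(0 :: 'n \<Rightarrow>\<^sub>0 nat) \<notin> range (\<lambda>k. Poly_Mapping.single k 1)"
      using single_1_nonzero by (metis imageE)
    then have "lookup (linear_form d) 0 = 0"
      by (rule lookup_linear_form)
    moreover have "lookup (Const (lookup p 0)) t = lookup p 0"
      by (simp add: 1 Const_def)
    ultimately show ?thesis
      by (simp add: 1 lookup_add)
  next
    case (2 k)
    have "lookup (Const (lookup p 0)) t = 0"
      using 2 single_1_nonzero[of k] by (simp add: Const_def lookup_single when_def)
    with 2 show ?thesis
      by (simp only: lookup_add lookup_linear_form lookup_Const_mult assms add_0)
  next
    case 3
    then have "lookup (Const (lookup p 0)) t = 0"
      by (auto simp: Const_def affine_monomials_def lookup_single when_def)
    with 3 show ?thesis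
      using lookup_eq_0_if_degree_le_1[OF assms(1) 3]
      by (simp add: lookup_add lookup_linear_form affine_monomials_def)
  qed
qed

text \<open>For distinct \<open>j\<close> and \<open>k\<close>, both sides are the coefficient of
  \<open>x_j x_k\<close> in the \<open>i\<close>-th component of the map.\<close>

lemma jacobian_linear_coeff_symmetric:
  assumes "is_jacobian M"
  shows "lookup (M $ i $ j) (Poly_Mapping.single k 1) = lookup (M $ i $ k) (Poly_Mapping.single j 1)"
  using assms
  by (auto simp: is_jacobian_def jacobian_def lookup_partial_deriv lookup_single when_def add.commute)

text \<open>This coefficient is twice that of the square of \<open>x_j\<close> in the
  \<open>i\<close>-th component of the map.\<close>

lemma jacobian_diagonal_coeff_char_2:
  fixes M :: "('n, 'a::comm_semiring_1) mpoly ^ 'n ^ 'm"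
  assumes "is_jacobian M" "(2 :: 'a) = 0"
  shows "lookup (M $ i $ j) (Poly_Mapping.single j 1) = 0"
  using assms by (auto simp: is_jacobian_def jacobian_def lookup_partial_deriv)

lemma second_index_neq_first_index:
  assumes "CARD('m::{finite,linorder}) \<ge> 2"
  shows "second_index \<noteq> (first_index :: 'm)"
proof -
  have "UNIV \<noteq> {first_index :: 'm}"
  proof
    assume "UNIV = {first_index :: 'm}"
    then have "CARD('m) = card {first_index :: 'm}" by (rule arg_cong)
    with assms show False by simp
  qed
  then have "Min (UNIV - {first_index :: 'm}) \<in> UNIV - {first_index}"
    by (intro Min_in) auto
  then show ?thesis by (auto simp: second_index_def)
qed

lemma two_le_card_if_independent:
  fixes x y :: "'a::field ^ 'm"
  assumes "vec.independent {x, y}" "x \<noteq> y"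
  shows "CARD('m) \<ge> 2"
  using vec.independent_card_le_dim[of "{x, y}" UNIV] assms vec.dim_UNIV
  by (simp add: card_insert_if vec_dim_card del: vec.dim_UNIV)

section \<open>Factorisation with one constant factor\<close>

text \<open>The two assumptions of \<open>rank_one_family\<close> for the coefficient matrices are
  the vanishing of the coefficients of the minors at \<open>t + t\<close> and at
  \<open>s + t\<close>. Monomials of higher degree contribute zero matrices.\<close>

lemma degree_le_1_minors_dichotomy:
  fixes M :: "('n::finite, 'a::field) mpoly ^ 'k ^ 'm"
  assumes deg: "\<And>i j. total_degree (M $ i $ j) \<le> 1"
    and minors: "\<And>i j k l. M $ i $ j * M $ k $ l = M $ i $ l * M $ k $ j"
  obtains (row) v w where "\<And>i j. M $ i $ j = Const (v $ i) * w j"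
    | (column) p d where "\<And>i j. M $ i $ j = p i * Const (d $ j)"
      "\<And>i. total_degree (p i) \<le> 1"
proof -
  let ?a = "\<lambda>t i j. lookup (M $ i $ j) t"
  have outside: "?a t i j = 0" if "t \<notin> affine_monomials" for t i j
    using lookup_eq_0_if_degree_le_1[OF deg that] .
  have "?a t i j * ?a t k l = ?a t i l * ?a t k j" for t i j k l
  proof (cases "t \<in> affine_monomials")
    case True
    then show ?thesis
      using arg_cong[OF minors, of "\<lambda>f. lookup f (t + t)" i j k l] by (simp add: lookup_affine_mult[OF deg deg])
  qed (simp add: outside)
  moreover have "?a s i j * ?a t k l + ?a t i j * ?a s k l = ?a s i l * ?a t k j + ?a t i l * ?a s k j"
    if "s \<noteq> t" for s t i j k l
  proof (cases "s \<in> affine_monomials \<and> t \<in> affine_monomials")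
    case True
    then show ?thesis
      using arg_cong[OF minors, of "\<lambda>f. lookup f (s + t)" i j k l] that
      by (simp add: lookup_affine_mult[OF deg deg])
  next
    case False
    then show ?thesis by (auto simp: outside)
  qed
  ultimately have "(\<exists>u w. \<forall>t i j. ?a t i j = u i * w t j) \<or> (\<exists>u w. \<forall>t i j. ?a t i j = u t i * w j)"
    by (rule rank_one_family)
  then show ?thesis
  proof (elim disjE exE)
    fix u w assume a: "\<forall>t i j. ?a t i j = u i * w t j"
    \<comment> \<open>If \<open>u\<close> is zero, so is \<open>M\<close>, and any index serves as
      \<open>i0\<close>.\<close>
    obtain i0 where i0: "u i0 \<noteq> 0 \<or> u = (\<lambda>_. 0)" by auto
    have "M $ i $ j = Const ((\<chi> i. u i / u i0) $ i) * M $ i0 $ j" for i j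
      using i0 by (intro poly_mapping_eqI) (auto simp: a)
    then show ?thesis by (rule row)
  next
    fix u w assume a: "\<forall>t i j. ?a t i j = u t i * w j"
    obtain j0 where j0: "w j0 \<noteq> 0 \<or> w = (\<lambda>_. 0)" by auto
    \<comment> \<open>The polynomial factor is a column of \<open>M\<close> itself and so inherits
      the degree bound.\<close>
    have "M $ i $ j = M $ i $ j0 * Const ((\<chi> j. w j / w j0) $ j)" for i j
      using j0 by (subst mult.commute, intro poly_mapping_eqI) (auto simp: a)
    then show ?thesis using deg by (rule column)
  qed
qed

section \<open>Jacobian matrices with a constant right factor\<close>

lemma jacobian_column_form:
  fixes M :: "('n, 'a::field) mpoly ^ 'n::{finite,linorder} ^ 'm::{finite,linorder}"
  assumes M: "\<And>i j. M $ i $ j = p i * Const (d $ j)" and deg: "\<And>i. total_degree (p i) \<le> 1"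
    and "M \<noteq> 0" and jac: "is_jacobian M"
  shows "\<exists>M'. equivalent_over M M' \<and> (only_first_row_nonzero M' \<or>
    only_first_column_nonzero M' \<and> star_half_zeros (column first_index M'))"
proof -
  have "d \<noteq> 0"
    using M \<open>M \<noteq> 0\<close> by (force simp: vec_eq_iff)
  then obtain j0 where j0: "d $ j0 \<noteq> 0" by (auto simp: vec_eq_iff)
  define \<alpha> where "\<alpha> = (\<chi> i. lookup (p i) (Poly_Mapping.single j0 1) / d $ j0)"
  define \<beta> where "\<beta> = (\<chi> i. lookup (p i) 0)"
  have lookup_M: "lookup (M $ i $ j) t = d $ j * lookup (p i) t" for i j t
    by (simp add: M mult.commute[of "p i"])
  \<comment> \<open>Symmetry for the columns \<open>j0\<close> and \<open>k\<close> equates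
    \<open>d $ j0\<close> times the coefficient of \<open>x_k\<close> in \<open>p i\<close> with
    \<open>d $ k\<close> times that of \<open>x_j0\<close>. Dividing by \<open>d $ j0\<close> makes
    the linear part of \<open>p i\<close> a multiple of \<open>linear_form d\<close>.\<close>
  have "lookup (p i) (Poly_Mapping.single k 1) = \<alpha> $ i * d $ k" for i k
    using jacobian_linear_coeff_symmetric[OF jac, of i j0 k] j0
    by (simp add: lookup_M \<alpha>_def field_simps)
  then have p: "p i = Const (\<beta> $ i) + Const (\<alpha> $ i) * linear_form d" for i
    using degree_le_1_eq_Const_plus_linear_form[OF deg] by (simp add: \<beta>_def)
  show ?thesis
  \<comment> \<open>The inequality is stated separately because the set
    \<open>{\<alpha>, \<beta>}\<close> collapses to a singleton, possibly independent, when the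
    vectors agree.\<close>
  proof (cases "\<alpha> \<noteq> \<beta> \<and> vec.independent {\<alpha>, \<beta>}")
    case False
    have "\<exists>v w. \<forall>i. p i = Const (v $ i) * w"
    proof -
      \<comment> \<open>The case \<open>\<alpha> = \<beta>\<close> falls under the second
        alternative with \<open>c = 1\<close>.\<close>
      consider "\<beta> = 0" | c where "\<alpha> = c *s \<beta>"
        using False independent_pair_iff by (metis vec.scale_one)
      then show ?thesis
      proof cases
        case 1
        then have "\<forall>i. p i = Const (\<alpha> $ i) * linear_form d" by (simp add: p)
        then show ?thesis by blast
      next
        case 2
        then have "\<forall>i. p i = Const (\<beta> $ i) * (1 + Const c * linear_form d)"
          by (simp add: p Const_mult algebra_simps)
        then show ?thesis by blast
      qed
    qed
    then obtain v w where "\<And>i. p i = Const (v $ i) * w" by blast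
    then have "\<And>i j. M $ i $ j = Const (v $ i) * (w * Const (d $ j))"
      by (simp add: M mult.assoc)
    then show ?thesis
      using only_first_row_form[of M v "\<lambda>j. w * Const (d $ j)"] \<open>M \<noteq> 0\<close> by metis
  next
    case True
    \<comment> \<open>The coefficient of \<open>x_j0\<close> in column \<open>j0\<close> of
      \<open>M\<close> is a nonzero multiple of \<open>\<alpha>\<close>; in characteristic 2 it
      vanishes, against independence.\<close>
    have two: "(2 :: 'a) \<noteq> 0"
    proof
      assume "(2 :: 'a) = 0"
      then have "lookup (p i) (Poly_Mapping.single j0 1) = 0" for i
        using jacobian_diagonal_coeff_char_2[OF jac, of i j0] j0 by (simp add: lookup_M)
      then have "\<alpha> = 0" by (simp add: \<alpha>_def vec_eq_iff)
      with True show False by (simp add: vec.dependent_zero)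
    qed
    have card: "CARD('m) \<ge> 2"
      using two_le_card_if_independent True by blast
    note neq = second_index_neq_first_index[OF card]
    \<comment> \<open>Sending \<open>\<alpha>\<close> to \<open>?e\<close> and
      \<open>\<beta>\<close> to \<open>?f\<close> turns \<open>p\<close> into
      \<open>linear_form d\<close> in the first entry, the constant 1/2 in the second and 0
      elsewhere. The pair is independent since \<open>two\<close> makes \<open>?f\<close> nonzero
      and \<open>neq\<close> separates the positions.\<close>
    let ?e = "axis first_index 1 :: ('a, 'm) vec" and ?f = "axis second_index (1 / 2) :: ('a, 'm) vec"
    have "?e \<noteq> c *s ?f" for c
    proof
      assume "?e = c *s ?f"
      then have "?e $ first_index = (c *s ?f) $ first_index" by simp
      with neq show False by (simp add: axis_def)
    qed
    moreover from this[of 1] have "?e \<noteq> ?f" by simp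
    moreover have "?f \<noteq> 0" using two by simp
    ultimately have "vec.independent {?e, ?f}" "?e \<noteq> ?f"
      using independent_pair_iff by blast+
    with True obtain S where S: "invertible S" "S *v \<alpha> = ?e" "S *v \<beta> = ?f"
      using exists_invertible_pair by metis
    obtain N where N: "equivalent_over M N" "only_first_column_nonzero N"
      "column first_index N = (\<chi> i. \<Sum>k\<in>UNIV. Const (S $ i $ k) * p k)"
      using only_first_column_form[OF M \<open>M \<noteq> 0\<close> S(1)] .
    have "(\<Sum>k\<in>UNIV. Const (S $ i $ k) * p k) = Const (?f $ i) + Const (?e $ i) * linear_form d" for i
      unfolding S(2,3)[symmetric] Const_matrix_vector_mult[symmetric]
      by (simp add: p ring_distribs sum.distrib sum_distrib_right mult.assoc)
    then have "star_half_zeros (column first_index N)"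
      using neq card two by (simp add: N(3) star_half_zeros_def axis_def)
    with N show ?thesis by blast
  qed
qed

theorem theorem2p1:
  fixes M :: "('n, 'a::field) mpoly ^ 'n::{finite,linorder} ^ 'm::{finite,linorder}"
  assumes "\<forall>i j. total_degree (M $ i $ j) \<le> 1"
    and "mpoly_rank M = 1"
  shows "(\<exists>M'. equivalent_over M M' \<and>
            (only_first_column_nonzero M' \<or> only_first_row_nonzero M')) \<and>
         (is_jacobian M \<longrightarrow>
           (\<exists>M'. equivalent_over M M' \<and>
              (only_first_row_nonzero M' \<or>
               only_first_column_nonzero M' \<and> star_half_zeros (column first_index M'))))"
proof -
  have "M \<noteq> 0"
    by (rule mpoly_rank_1_nonzero) (rule assms)
  show ?thesis
    using assms(1)[rule_format] mpoly_rank_1_minors[OF assms(2)]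
  proof (cases rule: degree_le_1_minors_dichotomy)
    case (row v w)
    \<comment> \<open>The row form answers both claims at once.\<close>
    then obtain M' where "equivalent_over M M'" "only_first_row_nonzero M'"
      using only_first_row_form \<open>M \<noteq> 0\<close> by blast
    then show ?thesis by blast
  next
    case (column p d)
    \<comment> \<open>The first claim leaves the column arbitrary, so no row operation is
      made.\<close>
    obtain N where "equivalent_over M N" "only_first_column_nonzero N"
      using only_first_column_form[OF column(1) \<open>M \<noteq> 0\<close> invertible_mat_one] by blast
    moreover have "\<exists>M'. equivalent_over M M' \<and> (only_first_row_nonzero M' \<or>
        only_first_column_nonzero M' \<and> star_half_zeros (column first_index M'))"
      if "is_jacobian M"
      using jacobian_column_form[OF column \<open>M \<noteq> 0\<close> that] by blast
    ultimately show ?thesis by blast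
  qed
qed

end
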